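(* Let $(X_k)_{k\ge1}$ be a stationary ergodic sequence of random variables with values in a bounded interval of $\mathbb{R}$, satisfying the Devroye inequality, and assume that the common distribution $\mu$ of the $X_k$'s is absolutely continuous with respect to Lebesgue measure, with density $\Phi$. Let $(\alpha_n)$ be a sequence of positive numbers converging to $0$ such that $n\alpha_n\to+\infty$. Assume that $$\int|\Phi(s)-\Phi(s-y)|\,ds\le C\,|y|^\tau$$ for some $C>0$, $\tau>0$ and any $y\in\mathbb{R}$. Suppose also that for any $\eta\in(0,1]$ there is a constant $C_\eta>0$ such that the auto-covariance $C_u(\ell)$ of any $\eta$-Hölder continuous function $u:\mathbb{R}\to\mathbb{R}$ satisfies $\sum_{\ell=1}^\infty|C_u(\ell)|\le C_\eta\Vert u\Vert_\eta^2$. Then, for any $\eta\in(0,1]$ and for any bounded, non-negative, Lipschitz continuous function $\psi:\mathbb{R}\to\mathbb{R}$ with compact support and integral equal to $1$, there exists a constant $C'=C'(\eta,\psi)>0$ such that for any integer $n\ge1$ and any $t>C'\big(\alpha_n^\tau+1/(\sqrt n\,\alpha_n^{1+\eta})\big)$, $$\mathbb{P}\left(\int|h_n(X_1,\ldots,X_n;s)-\Phi(s)|\,ds>t\right)\le\frac{C'}{t^2\,n\,\alpha_n^{2\eta}},\qquad\text{where}\quad h_n(X_1,\ldots,X_n;s)=\frac1{n\alpha_n}\sum_{j=1}^n\psi\big((s-X_j)/\alpha_n\big).$$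
   Context: Auto-covariance: $C_u(\ell)=\mathbb{E}(u(X_1)u(X_\ell))-(\mathbb{E}(u(X_1)))^2$, $\ell\ge1$. $\Vert u\Vert_\eta$ denotes the $\eta$-Hölder constant of $u$. Integrals in $s$ are over $\mathbb{R}$ with respect to Lebesgue measure. For $\eta\in(0,1]$, a function $K:\mathbb{R}^n\to\mathbb{R}$ is separately $\eta$-Hölder if for every $1\le j\le n$ $$L_j(K)=\sup_{x_1,\ldots,x_n}\ \sup_{\tilde x_j\ne x_j}\frac{|K(x_1,\ldots,x_j,\ldots,x_n)-K(x_1,\ldots,\tilde x_j,\ldots,x_n)|}{|x_j-\tilde x_j|^\eta}<\infty .$$ The process satisfies the Devroye inequality if for every $\eta\in(0,1]$ there is a constant $D=D(\eta)>0$ such that for every integer $n\ge1$ and every real-valued separately $\eta$-Hölder function $K$ on $\mathbb{R}^n$, $\mathrm{var}(K(X_1,\ldots,X_n))\le D\sum_{j=1}^n L_j(K)^2$. *)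

theory Defs
  imports "HOL-Probability.Probability"
begin

text \<open>
  A process \<open>X\<^sub>1, X\<^sub>2, \<dots>\<close> is a function \<open>X :: nat \<Rightarrow> 'a \<Rightarrow> real\<close>; the index \<open>0\<close> is never used.
  Its path is re-indexed from \<open>0\<close>, so that the path space is \<open>\<real>\<^sup>\<nat>\<close> with its product
  sigma-algebra.
\<close>

definition path_space :: "(nat \<Rightarrow> real) measure" where
  "path_space = PiM UNIV (\<lambda>_. borel)"

definition seq_law :: "'a measure \<Rightarrow> (nat \<Rightarrow> 'a \<Rightarrow> real) \<Rightarrow> (nat \<Rightarrow> real) measure" where
  "seq_law M X = distr M path_space (\<lambda>\<omega> k. X (Suc k) \<omega>)"

definition shift :: "(nat \<Rightarrow> real) \<Rightarrow> nat \<Rightarrow> real" where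
  "shift x = (\<lambda>k. x (Suc k))"

definition stationary :: "'a measure \<Rightarrow> (nat \<Rightarrow> 'a \<Rightarrow> real) \<Rightarrow> bool" where
  "stationary M X \<longleftrightarrow> distr (seq_law M X) path_space shift = seq_law M X"

definition ergodic :: "'a measure \<Rightarrow> (nat \<Rightarrow> 'a \<Rightarrow> real) \<Rightarrow> bool" where
  "ergodic M X \<longleftrightarrow>
    (\<forall>A\<in>sets path_space. shift -` A = A \<longrightarrow>
       measure (seq_law M X) A = 0 \<or> measure (seq_law M X) A = 1)"

definition holder_quotients :: "real \<Rightarrow> (real \<Rightarrow> real) \<Rightarrow> real set" where
  "holder_quotients \<eta> u = {\<bar>u x - u y\<bar> / \<bar>x - y\<bar> powr \<eta> | x y. x \<noteq> y}"

definition holder :: "real \<Rightarrow> (real \<Rightarrow> real) \<Rightarrow> bool" where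
  "holder \<eta> u \<longleftrightarrow> bdd_above (holder_quotients \<eta> u)"

text \<open>Meaningful only for \<open>holder \<eta> u\<close>, as is the corresponding constant \<open>sep_holder_const\<close>
  below: the real-valued supremum of an unbounded set is unspecified.\<close>

definition holder_const :: "real \<Rightarrow> (real \<Rightarrow> real) \<Rightarrow> real" where
  "holder_const \<eta> u = Sup (holder_quotients \<eta> u)"

text \<open>Points of \<open>\<real>\<^sup>n\<close> are the elements of \<open>{1..n} \<rightarrow>\<^sub>E UNIV\<close>, and only the values
  of \<open>K\<close> on this set matter.\<close>

definition sep_holder_quotients ::
  "real \<Rightarrow> nat \<Rightarrow> nat \<Rightarrow> ((nat \<Rightarrow> real) \<Rightarrow> real) \<Rightarrow> real set" where
  "sep_holder_quotients \<eta> n j K =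
    {\<bar>K x - K (x(j := y))\<bar> / \<bar>x j - y\<bar> powr \<eta> | x y. x \<in> {1..n} \<rightarrow>\<^sub>E UNIV \<and> y \<noteq> x j}"

definition sep_holder :: "real \<Rightarrow> nat \<Rightarrow> ((nat \<Rightarrow> real) \<Rightarrow> real) \<Rightarrow> bool" where
  "sep_holder \<eta> n K \<longleftrightarrow> (\<forall>j\<in>{1..n}. bdd_above (sep_holder_quotients \<eta> n j K))"

definition sep_holder_const :: "real \<Rightarrow> nat \<Rightarrow> nat \<Rightarrow> ((nat \<Rightarrow> real) \<Rightarrow> real) \<Rightarrow> real" where
  "sep_holder_const \<eta> n j K = Sup (sep_holder_quotients \<eta> n j K)"

definition devroye_inequality :: "'a measure \<Rightarrow> (nat \<Rightarrow> 'a \<Rightarrow> real) \<Rightarrow> bool" where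
  "devroye_inequality M X \<longleftrightarrow>
    (\<forall>\<eta>\<in>{0<..1}. \<exists>D>0. \<forall>n\<ge>1. \<forall>K. sep_holder \<eta> n K \<longrightarrow>
       prob_space.variance M (\<lambda>\<omega>. K (\<lambda>i\<in>{1..n}. X i \<omega>))
         \<le> D * (\<Sum>j=1..n. (sep_holder_const \<eta> n j K)\<^sup>2))"

definition auto_cov :: "'a measure \<Rightarrow> (nat \<Rightarrow> 'a \<Rightarrow> real) \<Rightarrow> (real \<Rightarrow> real) \<Rightarrow> nat \<Rightarrow> real" where
  "auto_cov M X u l =
    (\<integral>\<omega>. u (X 1 \<omega>) * u (X l \<omega>) \<partial>M) - (\<integral>\<omega>. u (X 1 \<omega>) \<partial>M)\<^sup>2"

definition kernel_density ::
  "(real \<Rightarrow> real) \<Rightarrow> (nat \<Rightarrow> real) \<Rightarrow> nat \<Rightarrow> (nat \<Rightarrow> real) \<Rightarrow> real \<Rightarrow> real" where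
  "kernel_density \<psi> \<alpha> n x s =
    1 / (real n * \<alpha> n) * (\<Sum>j=1..n. \<psi> ((s - x j) / \<alpha> n))"

end

theory Submission
  imports Defs
begin

text \<open>
  Devroye's inequality is used twice. The \<open>L\<^sup>1\<close> error \<open>K = \<integral> \<bar>h\<^sub>n - \<Phi>\<bar>\<close> changes by
  \<open>O(\<bar>x\<^sub>j - y\<bar>\<^sup>\<eta> / (n \<alpha>\<^sub>n\<^sup>\<eta>))\<close> when \<open>x\<^sub>j\<close> is replaced by \<open>y\<close>, since the two windows involved
  have length \<open>O(\<alpha>\<^sub>n)\<close>; hence \<open>var K = O(1 / (n \<alpha>\<^sub>n\<^sup>2\<^sup>\<eta>))\<close>, and Chebyshev's inequality applies
  as soon as \<open>t\<close> exceeds twice the expectation of \<open>K\<close>.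
  That expectation splits into the bias \<open>\<integral> \<bar>E h\<^sub>n - \<Phi>\<bar> = O(\<alpha>\<^sub>n\<^sup>\<tau>)\<close>, by the \<open>L\<^sup>1\<close> modulus of \<open>\<Phi>\<close>,
  and \<open>\<integral> E \<bar>h\<^sub>n - E h\<^sub>n\<bar>\<close>. The integrand of the latter vanishes outside a fixed bounded interval and
  is at most the standard deviation of \<open>h\<^sub>n(s)\<close>, which Devroye's inequality for the functional
  \<open>x \<mapsto> h\<^sub>n(x; s)\<close> bounds by \<open>O(1 / (\<surd>n \<alpha>\<^sub>n\<^sup>1\<^sup>+\<^sup>\<eta>))\<close>.
\<close>

section \<open>Hoelder moduli and the use of Devroye's inequality\<close>

text \<open>Up to distance 1 the Lipschitz bound wins, because there a distance is at most its power
  \<open>\<eta>\<close>; beyond 1 that power is at least 1 and the oscillation \<open>2 * b\<close>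
  suffices.\<close>

lemma lipschitz_bounded_imp_holder_bound:
  fixes f :: "real \<Rightarrow> real"
  assumes lip: "L-lipschitz_on UNIV f" and bnd: "\<And>x. \<bar>f x\<bar> \<le> b" and \<eta>: "0 < \<eta>" "\<eta> \<le> 1"
  shows "\<bar>f x - f y\<bar> \<le> (L + 2 * b) * \<bar>x - y\<bar> powr \<eta>"
proof -
  have L: "L \<ge> 0" using lipschitz_on_nonneg[OF lip] .
  have b: "b \<ge> 0" using bnd[of 0] by linarith
  show ?thesis
  proof (cases "\<bar>x - y\<bar> \<le> 1")
    case True
    have "\<bar>f x - f y\<bar> \<le> L * \<bar>x - y\<bar>"
      using lipschitz_onD[OF lip, of x y] by (simp add: dist_real_def)
    also have "\<bar>x - y\<bar> \<le> \<bar>x - y\<bar> powr \<eta>"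
      using powr_mono'[of \<eta> 1 "\<bar>x - y\<bar>"] True \<eta> by (cases "x = y") auto
    finally have "\<bar>f x - f y\<bar> \<le> L * \<bar>x - y\<bar> powr \<eta>" using L by (simp add: mult_left_mono)
    also have "\<dots> \<le> (L + 2 * b) * \<bar>x - y\<bar> powr \<eta>"
      using b by (intro mult_right_mono) auto
    finally show ?thesis .
  next
    case False
    have "\<bar>f x - f y\<bar> \<le> 2 * b" using bnd[of x] bnd[of y] by linarith
    also have "\<dots> \<le> (L + 2 * b) * 1" using L by simp
    also have "\<dots> \<le> (L + 2 * b) * \<bar>x - y\<bar> powr \<eta>"
      using L b False \<eta> by (intro mult_left_mono ge_one_powr_ge_zero) auto
    finally show ?thesis .
  qed
qed

text \<open>The modulus bounds every quotient by \<open>c\<close>, so the supremum is a genuine one.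
  It is asked at every vector, extensional or not, since the functionals below have it there and
  membership then never has to be checked.\<close>

lemma sep_holderI:
  assumes c: "\<And>j x y. j \<in> {1..n} \<Longrightarrow> \<bar>K x - K (x(j := y))\<bar> \<le> c * \<bar>x j - y\<bar> powr \<eta>"
  shows "sep_holder \<eta> n K"
    and "j \<in> {1..n} \<Longrightarrow> (sep_holder_const \<eta> n j K)\<^sup>2 \<le> c\<^sup>2"
proof -
  have le: "q \<le> c" if "j \<in> {1..n}" "q \<in> sep_holder_quotients \<eta> n j K" for q j
    using that(2) c[OF that(1)] unfolding sep_holder_quotients_def
    by (auto simp: divide_le_eq)
  then have bdd: "bdd_above (sep_holder_quotients \<eta> n j K)" if "j \<in> {1..n}" for j
    using that by (intro bdd_aboveI[of _ c]) auto
  then show "sep_holder \<eta> n K" unfolding sep_holder_def by (intro ballI)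
  assume j: "j \<in> {1..n}"
  \<comment> \<open>One explicit quotient shows that the set is nonempty and its supremum
    nonnegative; without the sign, the bound by \<open>c\<close> would not pass to squares.\<close>
  define x0 :: "nat \<Rightarrow> real" where "x0 = (\<lambda>i\<in>{1..n}. 0)"
  have el: "\<bar>K x0 - K (x0(j := 1))\<bar> / \<bar>x0 j - 1\<bar> powr \<eta> \<in> sep_holder_quotients \<eta> n j K"
    unfolding sep_holder_quotients_def using j by (auto simp: x0_def intro!: exI[of _ x0] exI[of _ 1])
  have "0 \<le> \<bar>K x0 - K (x0(j := 1))\<bar> / \<bar>x0 j - 1\<bar> powr \<eta>" by simp
  also have "\<dots> \<le> sep_holder_const \<eta> n j K"
    unfolding sep_holder_const_def using cSup_upper[OF el bdd[OF j]] .
  finally have 0: "0 \<le> sep_holder_const \<eta> n j K" .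
  have "sep_holder_const \<eta> n j K \<le> c"
    unfolding sep_holder_const_def using el le[OF j] by (intro cSup_least) auto
  with 0 show "(sep_holder_const \<eta> n j K)\<^sup>2 \<le> c\<^sup>2" by (rule power_mono[rotated])
qed

text \<open>\<open>D\<close> is fixed before \<open>n\<close>, \<open>K\<close> and
  \<open>c\<close>. One constant thus serves the pointwise and the integrated error at all sample
  sizes.\<close>

lemma devroye_variance_bound:
  assumes "devroye_inequality M X" "\<eta> \<in> {0<..1}"
  obtains D where "D > 0"
    "\<And>n K c. \<lbrakk>n \<ge> 1; \<And>j x y. j \<in> {1..n} \<Longrightarrow> \<bar>K x - K (x(j := y))\<bar> \<le> c * \<bar>x j - y\<bar> powr \<eta>\<rbrakk>
      \<Longrightarrow> prob_space.variance M (\<lambda>\<omega>. K (\<lambda>i\<in>{1..n}. X i \<omega>)) \<le> D * (real n * c\<^sup>2)"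
proof -
  obtain D where D: "D > 0" "\<And>n K. n \<ge> 1 \<Longrightarrow> sep_holder \<eta> n K \<Longrightarrow>
     prob_space.variance M (\<lambda>\<omega>. K (\<lambda>i\<in>{1..n}. X i \<omega>))
         \<le> D * (\<Sum>j=1..n. (sep_holder_const \<eta> n j K)\<^sup>2)"
    using assms unfolding devroye_inequality_def by metis
  show thesis
  proof (rule that[OF D(1)])
    fix n :: nat and K :: "(nat \<Rightarrow> real) \<Rightarrow> real" and c
    assume n: "n \<ge> 1"
      and c: "\<And>j x y. j \<in> {1..n} \<Longrightarrow> \<bar>K x - K (x(j := y))\<bar> \<le> c * \<bar>x j - y\<bar> powr \<eta>"
    have "(\<Sum>j=1..n. (sep_holder_const \<eta> n j K)\<^sup>2) \<le> (\<Sum>j=1..n. c\<^sup>2)"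
      by (intro sum_mono sep_holderI(2) c) auto
    also have "\<dots> = real n * c\<^sup>2" by simp
    finally have s: "(\<Sum>j=1..n. (sep_holder_const \<eta> n j K)\<^sup>2) \<le> real n * c\<^sup>2" .
    have "prob_space.variance M (\<lambda>\<omega>. K (\<lambda>i\<in>{1..n}. X i \<omega>))
        \<le> D * (\<Sum>j=1..n. (sep_holder_const \<eta> n j K)\<^sup>2)"
      by (intro D(2) n sep_holderI(1)[of n K c] c)
    also have "\<dots> \<le> D * (real n * c\<^sup>2)" using s D(1) by (intro mult_left_mono) auto
    finally show "prob_space.variance M (\<lambda>\<omega>. K (\<lambda>i\<in>{1..n}. X i \<omega>)) \<le> D * (real n * c\<^sup>2)" .
  qed
qed

text \<open>This is Jensen's inequality for the square, obtained from the nonnegative variance of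
  the absolute deviation.\<close>

lemma (in prob_space) expectation_abs_deviation_le:
  fixes f :: "'a \<Rightarrow> real"
  assumes "integrable M f" "integrable M (\<lambda>x. (f x)\<^sup>2)" "variance f \<le> v"
  shows "expectation (\<lambda>x. \<bar>f x - expectation f\<bar>) \<le> sqrt v"
proof -
  define Y where "Y x = f x - expectation f" for x
  have "integrable M (\<lambda>x. (f x)\<^sup>2 + ((expectation f)\<^sup>2 - 2 * expectation f * f x))"
    using assms by (intro Bochner_Integration.integrable_add Bochner_Integration.integrable_diff
        integrable_const integrable_mult_right) auto
  moreover have "(\<lambda>x. (f x)\<^sup>2 + ((expectation f)\<^sup>2 - 2 * expectation f * f x)) = (\<lambda>x. \<bar>Y x\<bar>\<^sup>2)"
    by (auto simp: Y_def power2_eq_square algebra_simps)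
  ultimately have i2: "integrable M (\<lambda>x. \<bar>Y x\<bar>\<^sup>2)" by simp
  have i1: "integrable M (\<lambda>x. \<bar>Y x\<bar>)" using assms unfolding Y_def by auto
  have "0 \<le> variance (\<lambda>x. \<bar>Y x\<bar>)" by (rule variance_positive)
  also have "\<dots> = expectation (\<lambda>x. \<bar>Y x\<bar>\<^sup>2) - (expectation (\<lambda>x. \<bar>Y x\<bar>))\<^sup>2"
    by (rule variance_eq[OF i1 i2])
  finally have "(expectation (\<lambda>x. \<bar>Y x\<bar>))\<^sup>2 \<le> v"
    using assms(3) by (simp add: Y_def)
  then show ?thesis unfolding Y_def by (rule real_le_rsqrt)
qed

section \<open>Kernel windows and the estimator for a fixed sample\<close>

text \<open>For a fixed exponent the estimates use \<open>\<psi>\<close> only through the radius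
  \<open>R\<close> of its support and the Hoelder factor \<open>H\<close>; boundedness is derived
  from these two.\<close>

locale holder_kernel =
  fixes \<psi> :: "real \<Rightarrow> real" and R H \<eta> :: real
  assumes nonneg: "\<psi> x \<ge> 0"
    and integrable: "integrable lborel \<psi>"
    and integral_eq_1: "(\<integral>x. \<psi> x \<partial>lborel) = 1"
    and support: "\<psi> x \<noteq> 0 \<Longrightarrow> \<bar>x\<bar> \<le> R"
    and holder_bound: "\<bar>\<psi> x - \<psi> y\<bar> \<le> H * \<bar>x - y\<bar> powr \<eta>"
    and R_pos: "R > 0" and H_pos: "H > 0"
begin

lemma measurable [measurable]: "\<psi> \<in> borel_measurable borel"
  using borel_measurable_integrable[OF integrable] by simp

text \<open>A shift by \<open>3 * R\<close> carries any point of the support out of it, so the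
  Hoelder bound compares \<open>\<psi> x\<close> with 0.\<close>

lemma kernel_le: "\<psi> x \<le> H * (3 * R) powr \<eta>"
proof (cases "\<psi> x = 0")
  case False
  have "\<psi> (x + 3 * R) = 0"
    using support[OF False] support[of "x + 3 * R"] R_pos by force
  then show ?thesis using holder_bound[of x "x + 3 * R"] R_pos by simp
qed (use H_pos in simp)

lemma window_integrable [simp]:
  assumes "a > 0"
  shows "integrable lborel (\<lambda>s. \<psi> ((s - x) / a))"
  using lborel_integrable_real_affine[OF integrable, of "1 / a" "- x / a"] assms
  by (simp add: field_simps)

lemma window_integral:
  assumes "a > 0"
  shows "(\<integral>s. \<psi> ((s - x) / a) \<partial>lborel) = a"
  using lborel_integral_real_affine[of a "\<lambda>s. \<psi> ((s - x) / a)" x] assms integral_eq_1 by simp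

lemma window_dist:
  assumes "a > 0"
  shows "\<bar>\<psi> ((s - x) / a) - \<psi> ((s - y) / a)\<bar> \<le> H / a powr \<eta> * \<bar>x - y\<bar> powr \<eta>"
proof -
  have "(s - x) / a - (s - y) / a = (y - x) / a" by (simp add: diff_divide_distrib)
  then have "\<bar>\<psi> ((s - x) / a) - \<psi> ((s - y) / a)\<bar> \<le> H * \<bar>(y - x) / a\<bar> powr \<eta>"
    using holder_bound[of "(s - x) / a" "(s - y) / a"] by simp
  also have "\<dots> = H / a powr \<eta> * \<bar>x - y\<bar> powr \<eta>"
    using assms by (simp add: powr_divide abs_minus_commute)
  finally show ?thesis .
qed

lemma window_eq_0:
  assumes "a > 0" "s \<notin> {x - R * a..x + R * a}"
  shows "\<psi> ((s - x) / a) = 0"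
proof (rule ccontr)
  assume "\<not> ?thesis"
  from support[OF this] have "\<bar>s - x\<bar> \<le> R * a"
    using assms(1) by (simp add: pos_divide_le_eq)
  with assms(2) show False by auto
qed

text \<open>The pointwise bound matters only on two windows of length \<open>2 * R * a\<close>. The
  factor \<open>a\<close> gained here later cancels the normalisation of the estimator.\<close>

lemma window_L1_dist:
  assumes a: "a > 0"
  shows "(\<integral>s. \<bar>\<psi> ((s - x) / a) - \<psi> ((s - y) / a)\<bar> \<partial>lborel)
    \<le> 4 * R * H * a / a powr \<eta> * \<bar>x - y\<bar> powr \<eta>"
proof -
  define c where "c = H / a powr \<eta> * \<bar>x - y\<bar> powr \<eta>"
  have c: "c \<ge> 0" using H_pos by (simp add: c_def)
  define J where "J z = {z - R * a..z + R * a}" for z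
  have [simp]: "integrable lborel (indicat_real (J z))" "measure lborel (J z) = 2 * R * a" for z
    using a R_pos by (auto simp: J_def)
  have "(\<integral>s. \<bar>\<psi> ((s - x) / a) - \<psi> ((s - y) / a)\<bar> \<partial>lborel)
      \<le> (\<integral>s. c * (indicat_real (J x) s + indicat_real (J y) s) \<partial>lborel)"
  proof (rule integral_mono)
    show "\<bar>\<psi> ((s - x) / a) - \<psi> ((s - y) / a)\<bar> \<le> c * (indicat_real (J x) s + indicat_real (J y) s)" for s
    proof (cases "s \<in> J x \<or> s \<in> J y")
      case True
      have "\<bar>\<psi> ((s - x) / a) - \<psi> ((s - y) / a)\<bar> \<le> c * 1"
        using window_dist[OF a] by (simp add: c_def)
      also have "\<dots> \<le> c * (indicat_real (J x) s + indicat_real (J y) s)"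
        using True c by (intro mult_left_mono) (auto simp: indicator_def)
      finally show ?thesis .
    next
      case False
      then show ?thesis using window_eq_0[OF a, of s x] window_eq_0[OF a, of s y] c
        by (simp add: J_def)
    qed
  qed (use a in auto)
  also have "\<dots> = c * (4 * R * a)" by (simp add: Bochner_Integration.integral_add)
  finally show ?thesis by (simp add: c_def mult_ac)
qed

lemma kernel_density_nonneg: "\<alpha> n > 0 \<Longrightarrow> kernel_density \<psi> \<alpha> n x s \<ge> 0"
  unfolding kernel_density_def by (intro mult_nonneg_nonneg sum_nonneg nonneg) auto

lemma kernel_density_integrable:
  "\<alpha> n > 0 \<Longrightarrow> integrable lborel (kernel_density \<psi> \<alpha> n x)"
  unfolding kernel_density_def[abs_def]
  by (intro integrable_mult_right Bochner_Integration.integrable_sum) simp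

lemma kernel_density_integral:
  assumes "\<alpha> n > 0" "n \<ge> 1"
  shows "(\<integral>s. kernel_density \<psi> \<alpha> n x s \<partial>lborel) = 1"
  using assms unfolding kernel_density_def
  by (simp add: Bochner_Integration.integral_sum window_integral)

lemma kernel_density_le:
  assumes "\<alpha> n > 0" "n \<ge> 1"
  shows "kernel_density \<psi> \<alpha> n x s \<le> H * (3 * R) powr \<eta> / \<alpha> n"
proof -
  have "(\<Sum>j=1..n. \<psi> ((s - x j) / \<alpha> n)) \<le> (\<Sum>j=1..n. H * (3 * R) powr \<eta>)"
    by (intro sum_mono kernel_le)
  then show ?thesis using assms by (simp add: kernel_density_def divide_simps mult_ac)
qed

lemma kernel_density_eq_0:
  assumes "\<alpha> n > 0" "\<And>j. j \<in> {1..n} \<Longrightarrow> \<bar>x j\<bar> \<le> B" "\<bar>s\<bar> > B + R * \<alpha> n"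
  shows "kernel_density \<psi> \<alpha> n x s = 0"
proof -
  have "\<psi> ((s - x j) / \<alpha> n) = 0" if "j \<in> {1..n}" for j
    using assms(2)[OF that] assms(3) by (intro window_eq_0 assms(1)) auto
  then show ?thesis by (simp add: kernel_density_def)
qed

lemma kernel_density_update:
  assumes "j \<in> {1..n}"
  shows "kernel_density \<psi> \<alpha> n x s - kernel_density \<psi> \<alpha> n (x(j := y)) s
    = (\<psi> ((s - x j) / \<alpha> n) - \<psi> ((s - y) / \<alpha> n)) / (real n * \<alpha> n)"
proof -
  have "(\<Sum>i\<in>{1..n} - {j}. \<psi> ((s - (x(j := y)) i) / \<alpha> n)) = (\<Sum>i\<in>{1..n} - {j}. \<psi> ((s - x i) / \<alpha> n))"
    by (intro sum.cong) auto
  then show ?thesis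
    unfolding kernel_density_def sum.remove[OF finite_atLeastAtMost assms]
    by (simp add: diff_divide_distrib add_divide_distrib)
qed

text \<open>At a single point \<open>s\<close> no window length is gained, so the normalisation
  costs a full power of \<open>\<alpha> n\<close> besides \<open>\<alpha> n powr \<eta>\<close>.
  This is the origin of the exponent \<open>1 + \<eta>\<close> in the threshold for
  \<open>t\<close>.\<close>

lemma kernel_density_pointwise_holder:
  assumes "j \<in> {1..n}" and a: "\<alpha> n > 0"
  shows "\<bar>kernel_density \<psi> \<alpha> n x s - kernel_density \<psi> \<alpha> n (x(j := y)) s\<bar>
    \<le> H / (real n * \<alpha> n powr (1 + \<eta>)) * \<bar>x j - y\<bar> powr \<eta>"
proof -
  have "\<bar>kernel_density \<psi> \<alpha> n x s - kernel_density \<psi> \<alpha> n (x(j := y)) s\<bar>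
      = \<bar>\<psi> ((s - x j) / \<alpha> n) - \<psi> ((s - y) / \<alpha> n)\<bar> / (real n * \<alpha> n)"
    using a by (simp add: kernel_density_update[OF assms(1)] abs_mult)
  also have "\<dots> \<le> (H / \<alpha> n powr \<eta> * \<bar>x j - y\<bar> powr \<eta>) / (real n * \<alpha> n)"
    using a by (intro divide_right_mono window_dist) auto
  also have "\<dots> = H / (real n * \<alpha> n powr (1 + \<eta>)) * \<bar>x j - y\<bar> powr \<eta>"
    using a by (simp add: powr_add)
  finally show ?thesis .
qed

text \<open>The reverse triangle inequality removes \<open>\<Phi>\<close>, and integration over the
  windows absorbs the factor \<open>1 / \<alpha> n\<close>. Only
  \<open>\<alpha> n powr \<eta>\<close> is lost, whence the exponent \<open>2 * \<eta>\<close> in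
  the tail bound.\<close>

lemma kernel_density_L1_error_holder:
  assumes j: "j \<in> {1..n}" and a: "\<alpha> n > 0" and \<Phi>: "integrable lborel \<Phi>"
  shows "\<bar>(\<integral>s. \<bar>kernel_density \<psi> \<alpha> n x s - \<Phi> s\<bar> \<partial>lborel)
      - (\<integral>s. \<bar>kernel_density \<psi> \<alpha> n (x(j := y)) s - \<Phi> s\<bar> \<partial>lborel)\<bar>
    \<le> 4 * R * H / (real n * \<alpha> n powr \<eta>) * \<bar>x j - y\<bar> powr \<eta>"
proof -
  let ?h = "kernel_density \<psi> \<alpha> n x" and ?h' = "kernel_density \<psi> \<alpha> n (x(j := y))"
  have [simp]: "integrable lborel ?h" "integrable lborel ?h'"
    by (intro kernel_density_integrable a)+
  have "\<bar>(\<integral>s. \<bar>?h s - \<Phi> s\<bar> \<partial>lborel) - (\<integral>s. \<bar>?h' s - \<Phi> s\<bar> \<partial>lborel)\<bar>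
      = \<bar>\<integral>s. \<bar>?h s - \<Phi> s\<bar> - \<bar>?h' s - \<Phi> s\<bar> \<partial>lborel\<bar>"
    using \<Phi> by (subst Bochner_Integration.integral_diff) auto
  also have "\<dots> \<le> (\<integral>s. \<bar>\<bar>?h s - \<Phi> s\<bar> - \<bar>?h' s - \<Phi> s\<bar>\<bar> \<partial>lborel)"
    by (rule integral_abs_bound)
  also have "\<dots> \<le> (\<integral>s. \<bar>?h s - ?h' s\<bar> \<partial>lborel)"
    using \<Phi> by (intro integral_mono) auto
  also have "\<dots> = (\<integral>s. \<bar>\<psi> ((s - x j) / \<alpha> n) - \<psi> ((s - y) / \<alpha> n)\<bar> / (real n * \<alpha> n) \<partial>lborel)"
    using a by (simp add: kernel_density_update[OF j] abs_mult)
  also have "\<dots> = (\<integral>s. \<bar>\<psi> ((s - x j) / \<alpha> n) - \<psi> ((s - y) / \<alpha> n)\<bar> \<partial>lborel) / (real n * \<alpha> n)"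
    by simp
  also have "\<dots> \<le> (4 * R * H * \<alpha> n / \<alpha> n powr \<eta> * \<bar>x j - y\<bar> powr \<eta>) / (real n * \<alpha> n)"
    using a by (intro divide_right_mono window_L1_dist) auto
  also have "\<dots> = 4 * R * H / (real n * \<alpha> n powr \<eta>) * \<bar>x j - y\<bar> powr \<eta>"
    using a by (simp add: mult_ac)
  finally show ?thesis .
qed

text \<open>A bound uniform in the sample makes the error a bounded random variable, hence square
  integrable.\<close>

lemma kernel_density_L1_error_le:
  assumes a: "\<alpha> n > 0" and n: "n \<ge> 1" and \<Phi>: "integrable lborel \<Phi>" "\<And>s. \<Phi> s \<ge> 0"
  shows "(\<integral>s. \<bar>kernel_density \<psi> \<alpha> n x s - \<Phi> s\<bar> \<partial>lborel) \<le> 1 + (\<integral>s. \<Phi> s \<partial>lborel)"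
proof -
  have h: "integrable lborel (kernel_density \<psi> \<alpha> n x)"
    by (intro kernel_density_integrable a)
  have "(\<integral>s. \<bar>kernel_density \<psi> \<alpha> n x s - \<Phi> s\<bar> \<partial>lborel) \<le> (\<integral>s. kernel_density \<psi> \<alpha> n x s + \<Phi> s \<partial>lborel)"
  proof (rule integral_mono)
    show "\<bar>kernel_density \<psi> \<alpha> n x s - \<Phi> s\<bar> \<le> kernel_density \<psi> \<alpha> n x s + \<Phi> s" for s
      using kernel_density_nonneg[of \<alpha> n x s, OF a] \<Phi>(2)[of s] by linarith
  qed (use h \<Phi> in auto)
  also have "\<dots> = 1 + (\<integral>s. \<Phi> s \<partial>lborel)"
    using h \<Phi> by (simp add: kernel_density_integral[of \<alpha> n x, OF a n])
  finally show ?thesis .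
qed

section \<open>The bias of the smoothed density\<close>

text \<open>After substituting \<open>x = s - a * v\<close> the bias is a
  \<open>\<psi>\<close>-average of differences of \<open>\<Phi>\<close> at distance
  \<open>a * v\<close>. Integrating in \<open>s\<close> first, the modulus applies to shifts of size
  at most \<open>R * a\<close>. With nonnegative integrals the exchange needs only
  measurability.\<close>

lemma smoothing_bias:
  assumes a: "a > 0" and \<Phi>: "integrable lborel \<Phi>" and "C \<ge> 0" "\<tau> > 0"
    and mod: "\<And>y. (\<integral>s. \<bar>\<Phi> s - \<Phi> (s - y)\<bar> \<partial>lborel) \<le> C * \<bar>y\<bar> powr \<tau>"
  shows "(\<integral>\<^sup>+s. ennreal \<bar>(\<integral>x. \<Phi> x * (\<psi> ((s - x) / a) / a) \<partial>lborel) - \<Phi> s\<bar> \<partial>lborel)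
    \<le> ennreal (C * R powr \<tau> * a powr \<tau>)"
proof -
  have [measurable]: "\<Phi> \<in> borel_measurable borel"
    using borel_measurable_integrable[OF \<Phi>] by simp
  have pt: "ennreal \<bar>(\<integral>x. \<Phi> x * (\<psi> ((s - x) / a) / a) \<partial>lborel) - \<Phi> s\<bar>
      \<le> (\<integral>\<^sup>+v. ennreal (\<psi> v) * ennreal \<bar>\<Phi> s - \<Phi> (s - a * v)\<bar> \<partial>lborel)" for s
  proof -
    \<comment> \<open>\<open>\<Phi>\<close> may be unbounded; the bounded kernel makes the product
      integrable for every \<open>s\<close>.\<close>
    have int: "integrable lborel (\<lambda>x. \<Phi> x * (\<psi> ((s - x) / a) / a))"
    proof (rule Bochner_Integration.integrable_bound)
      show "integrable lborel (\<lambda>x. \<Phi> x * (H * (3 * R) powr \<eta> / a))" using \<Phi> by simp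
      show "AE x in lborel. norm (\<Phi> x * (\<psi> ((s - x) / a) / a)) \<le> norm (\<Phi> x * (H * (3 * R) powr \<eta> / a))"
      proof (rule AE_I2)
        fix x
        show "norm (\<Phi> x * (\<psi> ((s - x) / a) / a)) \<le> norm (\<Phi> x * (H * (3 * R) powr \<eta> / a))"
          unfolding norm_mult using a nonneg[of "(s - x) / a"] kernel_le[of "(s - x) / a"] H_pos
          by (intro mult_left_mono) (auto simp: divide_right_mono)
      qed
    qed simp
    have eq: "(\<integral>x. \<Phi> x * (\<psi> ((s - x) / a) / a) \<partial>lborel) = (\<integral>v. \<Phi> (s - a * v) * \<psi> v \<partial>lborel)"
      using lborel_integral_real_affine[of "-a" "\<lambda>x. \<Phi> x * (\<psi> ((s - x) / a) / a)" s] a by simp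
    have int': "integrable lborel (\<lambda>v. \<Phi> (s - a * v) * \<psi> v)"
      using integrable_mult_right[OF lborel_integrable_real_affine[OF int, of "-a" s], of a] a
      by (simp add: mult_ac)
    \<comment> \<open>The unit mass of \<open>\<psi>\<close> brings \<open>\<Phi> s\<close> under
      the integral.\<close>
    have "(\<integral>v. \<Phi> (s - a * v) * \<psi> v \<partial>lborel) - \<Phi> s = (\<integral>v. \<Phi> (s - a * v) * \<psi> v - \<Phi> s * \<psi> v \<partial>lborel)"
      using int' integrable integral_eq_1 by simp
    also have "\<dots> = (\<integral>v. \<psi> v * (\<Phi> (s - a * v) - \<Phi> s) \<partial>lborel)"
      by (simp add: algebra_simps)
    finally have "\<bar>(\<integral>x. \<Phi> x * (\<psi> ((s - x) / a) / a) \<partial>lborel) - \<Phi> s\<bar> = norm (\<integral>v. \<psi> v * (\<Phi> (s - a * v) - \<Phi> s) \<partial>lborel)"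
      by (simp only: eq real_norm_def)
    also have "ennreal \<dots> \<le> (\<integral>\<^sup>+v. ennreal (norm (\<psi> v * (\<Phi> (s - a * v) - \<Phi> s))) \<partial>lborel)"
    proof (rule integral_norm_bound_ennreal)
      show "integrable lborel (\<lambda>v. \<psi> v * (\<Phi> (s - a * v) - \<Phi> s))"
        using Bochner_Integration.integrable_diff[OF int' integrable_mult_right[OF integrable, of "\<Phi> s"]]
        by (simp add: algebra_simps)
    qed
    also have "\<dots> = (\<integral>\<^sup>+v. ennreal (\<psi> v) * ennreal \<bar>\<Phi> s - \<Phi> (s - a * v)\<bar> \<partial>lborel)"
      by (intro nn_integral_cong) (simp add: abs_mult ennreal_mult nonneg abs_minus_commute)
    finally show ?thesis .
  qed
  have shift: "(\<integral>\<^sup>+s. ennreal (\<psi> v) * ennreal \<bar>\<Phi> s - \<Phi> (s - a * v)\<bar> \<partial>lborel)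
      \<le> ennreal (C * R powr \<tau> * a powr \<tau>) * ennreal (\<psi> v)" for v
  \<comment> \<open>Both sides vanish where \<open>\<psi> v = 0\<close>; elsewhere the support
    condition gives the bound \<open>R\<close> on the size of \<open>v\<close>.\<close>
  proof (cases "\<psi> v = 0")
    case False
    have "integrable lborel (\<lambda>s. \<Phi> (s - a * v))"
      using lborel_integrable_real_affine[OF \<Phi>, of 1 "- a * v"] by (simp add: add.commute)
    then have "(\<integral>\<^sup>+s. ennreal \<bar>\<Phi> s - \<Phi> (s - a * v)\<bar> \<partial>lborel) = ennreal (\<integral>s. \<bar>\<Phi> s - \<Phi> (s - a * v)\<bar> \<partial>lborel)"
      using \<Phi> by (intro nn_integral_eq_integral) auto
    also have "\<dots> \<le> ennreal (C * R powr \<tau> * a powr \<tau>)"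
    proof (rule ennreal_leI)
      have "(\<integral>s. \<bar>\<Phi> s - \<Phi> (s - a * v)\<bar> \<partial>lborel) \<le> C * \<bar>a * v\<bar> powr \<tau>" by (rule mod)
      also have "\<dots> \<le> C * (R * a) powr \<tau>"
        using a support[OF False] \<open>C \<ge> 0\<close> \<open>\<tau> > 0\<close>
        by (intro mult_left_mono powr_mono2) (auto simp: abs_mult mult.commute)
      also have "\<dots> = C * R powr \<tau> * a powr \<tau>" using a R_pos by (simp add: powr_mult)
      finally show "(\<integral>s. \<bar>\<Phi> s - \<Phi> (s - a * v)\<bar> \<partial>lborel) \<le> C * R powr \<tau> * a powr \<tau>" .
    qed
    finally show ?thesis
      by (subst nn_integral_cmult) (auto simp: mult.commute intro: mult_left_mono)
  qed simp
  have "(\<integral>\<^sup>+s. ennreal \<bar>(\<integral>x. \<Phi> x * (\<psi> ((s - x) / a) / a) \<partial>lborel) - \<Phi> s\<bar> \<partial>lborel)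
      \<le> (\<integral>\<^sup>+s. (\<integral>\<^sup>+v. ennreal (\<psi> v) * ennreal \<bar>\<Phi> s - \<Phi> (s - a * v)\<bar> \<partial>lborel) \<partial>lborel)"
    by (intro nn_integral_mono pt)
  also have "\<dots> = (\<integral>\<^sup>+v. (\<integral>\<^sup>+s. ennreal (\<psi> v) * ennreal \<bar>\<Phi> s - \<Phi> (s - a * v)\<bar> \<partial>lborel) \<partial>lborel)"
    by (rule lborel_pair.Fubini') simp
  also have "\<dots> \<le> (\<integral>\<^sup>+v. ennreal (C * R powr \<tau> * a powr \<tau>) * ennreal (\<psi> v) \<partial>lborel)"
    by (intro nn_integral_mono shift)
  also have "\<dots> = ennreal (C * R powr \<tau> * a powr \<tau>) * ennreal (\<integral>v. \<psi> v \<partial>lborel)"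
    by (simp add: nn_integral_cmult nn_integral_eq_integral integrable nonneg)
  finally show ?thesis by (simp add: integral_eq_1)
qed

end

section \<open>Mean and tail of a random L1 error\<close>

text \<open>Inserting the mean \<open>g\<close> separates fluctuation and bias. The fluctuation
  lives on an interval of length \<open>2 * S\<close>, which turns the pointwise bound
  \<open>\<sigma>\<close> into an integrated one.\<close>

lemma (in prob_space) expected_L1_error_le:
  fixes h :: "'a \<Rightarrow> real \<Rightarrow> real" and \<Phi> :: "real \<Rightarrow> real"
  defines "g \<equiv> \<lambda>s. expectation (\<lambda>\<omega>. h \<omega> s)"
  assumes h [measurable]: "case_prod h \<in> borel_measurable (M \<Otimes>\<^sub>M lborel)"
    and \<Phi> [measurable]: "\<Phi> \<in> borel_measurable borel"
    and int: "\<And>s. integrable M (\<lambda>\<omega>. h \<omega> s)"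
    and dev: "\<And>s. expectation (\<lambda>\<omega>. \<bar>h \<omega> s - g s\<bar>) \<le> \<sigma>"
    and supp: "\<And>\<omega> s. \<omega> \<in> space M \<Longrightarrow> \<bar>s\<bar> > S \<Longrightarrow> h \<omega> s = 0"
    and bias: "(\<integral>\<^sup>+s. ennreal \<bar>g s - \<Phi> s\<bar> \<partial>lborel) \<le> ennreal b"
    and nn: "S \<ge> 0" "b \<ge> 0" "\<sigma> \<ge> 0"
  shows "expectation (\<lambda>\<omega>. \<integral>s. \<bar>h \<omega> s - \<Phi> s\<bar> \<partial>lborel) \<le> 2 * S * \<sigma> + b"
proof -
  interpret P: pair_sigma_finite M lborel ..
  have [measurable]: "(\<lambda>\<omega>. h \<omega> s) \<in> borel_measurable M" for s using int by blast
  have [measurable]: "g \<in> borel_measurable lborel" unfolding g_def by measurable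
  have [measurable]: "(\<lambda>(\<omega>, s). \<bar>h \<omega> s - g s\<bar>) \<in> borel_measurable (M \<Otimes>\<^sub>M lborel)" by measurable
  have [measurable]: "(\<lambda>(\<omega>, s). \<bar>h \<omega> s - \<Phi> s\<bar>) \<in> borel_measurable (M \<Otimes>\<^sub>M lborel)" by measurable
  \<comment> \<open>The mean inherits the support of \<open>h\<close>, so the deviation vanishes
    outside \<open>{-S..S}\<close> as well.\<close>
  have g0: "g s = 0" if "\<bar>s\<bar> > S" for s
    using supp[OF _ that] unfolding g_def by (simp cong: Bochner_Integration.integral_cong)
  have dev': "(\<integral>\<^sup>+\<omega>. ennreal \<bar>h \<omega> s - g s\<bar> \<partial>M) \<le> ennreal \<sigma> * indicator {-S..S} s" for s
  proof (cases "\<bar>s\<bar> > S")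
    case True
    then show ?thesis using supp[OF _ True] g0[OF True] by (simp cong: nn_integral_cong)
  next
    case False
    have "(\<integral>\<^sup>+\<omega>. ennreal \<bar>h \<omega> s - g s\<bar> \<partial>M) = ennreal (expectation (\<lambda>\<omega>. \<bar>h \<omega> s - g s\<bar>))"
      using int by (intro nn_integral_eq_integral) auto
    also have "\<dots> \<le> ennreal \<sigma>" by (intro ennreal_leI dev)
    finally show ?thesis using False by (auto simp: indicator_def)
  qed
  \<comment> \<open>This holds for every \<open>f\<close>: the Bochner integral takes the value 0
    when the integrand is not integrable.\<close>
  have le: "ennreal (\<integral>s. \<bar>f s\<bar> \<partial>lborel) \<le> (\<integral>\<^sup>+s. ennreal \<bar>f s\<bar> \<partial>lborel)" for f :: "real \<Rightarrow> real"
    by (cases "integrable lborel (\<lambda>s. \<bar>f s\<bar>)")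
       (simp_all add: nn_integral_eq_integral not_integrable_integral_eq)
  have "expectation (\<lambda>\<omega>. \<integral>s. \<bar>h \<omega> s - \<Phi> s\<bar> \<partial>lborel)
      = enn2real (\<integral>\<^sup>+\<omega>. ennreal (\<integral>s. \<bar>h \<omega> s - \<Phi> s\<bar> \<partial>lborel) \<partial>M)"
    by (intro integral_eq_nn_integral AE_I2 integral_nonneg_AE) auto
  also have "\<dots> \<le> 2 * S * \<sigma> + b"
  proof (rule enn2real_leI)
    have "(\<integral>\<^sup>+\<omega>. ennreal (\<integral>s. \<bar>h \<omega> s - \<Phi> s\<bar> \<partial>lborel) \<partial>M)
        \<le> (\<integral>\<^sup>+\<omega>. (\<integral>\<^sup>+s. ennreal \<bar>h \<omega> s - \<Phi> s\<bar> \<partial>lborel) \<partial>M)"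
      by (intro nn_integral_mono le)
    also have "\<dots> = (\<integral>\<^sup>+s. (\<integral>\<^sup>+\<omega>. ennreal \<bar>h \<omega> s - \<Phi> s\<bar> \<partial>M) \<partial>lborel)"
      by (rule P.Fubini'[symmetric]) measurable
    also have "\<dots> \<le> (\<integral>\<^sup>+s. (\<integral>\<^sup>+\<omega>. ennreal \<bar>h \<omega> s - g s\<bar> + ennreal \<bar>g s - \<Phi> s\<bar> \<partial>M) \<partial>lborel)"
      by (intro nn_integral_mono) (simp add: ennreal_plus[symmetric] del: ennreal_plus)
    also have "\<dots> = (\<integral>\<^sup>+s. (\<integral>\<^sup>+\<omega>. ennreal \<bar>h \<omega> s - g s\<bar> \<partial>M) + ennreal \<bar>g s - \<Phi> s\<bar> \<partial>lborel)"
      by (intro nn_integral_cong) (subst nn_integral_add, auto simp: emeasure_space_1)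
    also have "\<dots> \<le> (\<integral>\<^sup>+s. ennreal \<sigma> * indicator {-S..S} s + ennreal \<bar>g s - \<Phi> s\<bar> \<partial>lborel)"
      by (intro nn_integral_mono add_right_mono dev')
    also have "\<dots> = ennreal \<sigma> * ennreal (2 * S) + (\<integral>\<^sup>+s. ennreal \<bar>g s - \<Phi> s\<bar> \<partial>lborel)"
      using nn by (subst nn_integral_add) (auto simp: nn_integral_cmult)
    also have "\<dots> \<le> ennreal \<sigma> * ennreal (2 * S) + ennreal b" using bias by (rule add_left_mono)
    also have "\<dots> = ennreal (2 * S * \<sigma> + b)"
      using nn by (simp add: ennreal_mult[symmetric] mult_ac)
    finally show "(\<integral>\<^sup>+\<omega>. ennreal (\<integral>s. \<bar>h \<omega> s - \<Phi> s\<bar> \<partial>lborel) \<partial>M) \<le> ennreal (2 * S * \<sigma> + b)" .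
  qed (use nn in simp)
  finally show ?thesis .
qed

text \<open>When the mean is at most \<open>t / 2\<close>, exceeding \<open>t\<close> is a deviation
  of at least \<open>t / 2\<close>; Chebyshev's inequality then produces the factor 4.\<close>

lemma (in prob_space) tail_le_of_expectation_variance:
  fixes f :: "'a \<Rightarrow> real"
  assumes [measurable]: "f \<in> borel_measurable M" and "integrable M (\<lambda>x. (f x)\<^sup>2)"
    and "expectation f \<le> t / 2" "variance f \<le> v" "t > 0"
  shows "prob {x \<in> space M. f x > t} \<le> 4 * v / t\<^sup>2"
proof -
  have "prob {x \<in> space M. f x > t} \<le> prob {x \<in> space M. \<bar>f x - expectation f\<bar> \<ge> t / 2}"
    using assms(3) by (intro finite_measure_mono) (auto simp: abs_if)
  also have "\<dots> \<le> variance f / (t / 2)\<^sup>2"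
    using assms by (intro Chebyshev_inequality) auto
  also have "\<dots> \<le> v / (t / 2)\<^sup>2" using assms by (intro divide_right_mono) auto
  finally show ?thesis by (simp add: power_divide mult_ac)
qed

section \<open>The estimator along the process\<close>

context holder_kernel
begin

text \<open>All \<open>X j\<close> share the density \<open>\<Phi>\<close>, so the \<open>n\<close>
  terms have equal means and linearity cancels the factor \<open>1 / n\<close>.\<close>

lemma expectation_kernel_density:
  assumes "prob_space M" and n: "n \<ge> 1" and a: "\<alpha> n > 0"
    and X: "\<And>k. k \<ge> 1 \<Longrightarrow> distributed M lborel (X k) (\<lambda>s. ennreal (\<Phi> s))"
    and \<Phi>: "\<And>s. \<Phi> s \<ge> 0"
  shows "integrable M (\<lambda>\<omega>. kernel_density \<psi> \<alpha> n (\<lambda>j. X j \<omega>) s)" (is ?int)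
    and "(\<integral>\<omega>. kernel_density \<psi> \<alpha> n (\<lambda>j. X j \<omega>) s \<partial>M)
      = (\<integral>x. \<Phi> x * (\<psi> ((s - x) / \<alpha> n) / \<alpha> n) \<partial>lborel)" (is ?eq)
proof -
  interpret prob_space M by fact
  have [measurable]: "X k \<in> borel_measurable M" if "k \<ge> 1" for k
    using distributed_measurable[OF X[OF that]] by simp
  have 1: "integrable M (\<lambda>\<omega>. \<psi> ((s - X j \<omega>) / \<alpha> n))" if "j \<in> {1..n}" for j
  proof (rule integrable_const_bound[where B="H * (3 * R) powr \<eta>"])
    have [measurable]: "X j \<in> borel_measurable M" using that by simp
    show "(\<lambda>\<omega>. \<psi> ((s - X j \<omega>) / \<alpha> n)) \<in> borel_measurable M" by measurable
    show "AE \<omega> in M. norm (\<psi> ((s - X j \<omega>) / \<alpha> n)) \<le> H * (3 * R) powr \<eta>"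
      using nonneg kernel_le by (intro AE_I2) simp
  qed
  then show ?int unfolding kernel_density_def
    by (intro integrable_mult_right Bochner_Integration.integrable_sum)
  have 2: "(\<integral>\<omega>. \<psi> ((s - X j \<omega>) / \<alpha> n) \<partial>M) = (\<integral>x. \<Phi> x * \<psi> ((s - x) / \<alpha> n) \<partial>lborel)"
    if "j \<in> {1..n}" for j
    using that \<Phi> by (intro distributed_integral[OF X, symmetric]) auto
  have "(\<integral>\<omega>. kernel_density \<psi> \<alpha> n (\<lambda>j. X j \<omega>) s \<partial>M)
      = 1 / (real n * \<alpha> n) * (\<Sum>j=1..n. \<integral>\<omega>. \<psi> ((s - X j \<omega>) / \<alpha> n) \<partial>M)"
    unfolding kernel_density_def using 1
    by (simp add: Bochner_Integration.integral_sum)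
  also have "\<dots> = 1 / (real n * \<alpha> n) * (\<Sum>j=1..n. \<integral>x. \<Phi> x * \<psi> ((s - x) / \<alpha> n) \<partial>lborel)"
    using 2 by simp
  also have "\<dots> = (\<integral>x. \<Phi> x * (\<psi> ((s - x) / \<alpha> n) / \<alpha> n) \<partial>lborel)"
    using n by simp
  finally show ?eq .
qed

lemma devroye_tail_bound:
  assumes M: "prob_space M"
    and dev: "devroye_inequality M X" and \<eta>: "\<eta> \<in> {0<..1}"
    and B: "\<And>k \<omega>. k \<ge> 1 \<Longrightarrow> \<omega> \<in> space M \<Longrightarrow> \<bar>X k \<omega>\<bar> \<le> B" "B > 0"
    and X: "\<And>k. k \<ge> 1 \<Longrightarrow> distributed M lborel (X k) (\<lambda>s. ennreal (\<Phi> s))"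
    and \<Phi>: "\<And>s. \<Phi> s \<ge> 0"
    and \<alpha>: "\<And>n. n \<ge> 1 \<Longrightarrow> \<alpha> n > 0" "\<And>n. \<alpha> n \<le> A"
    and mod: "\<And>y. (\<integral>s. \<bar>\<Phi> s - \<Phi> (s - y)\<bar> \<partial>lborel) \<le> C * \<bar>y\<bar> powr \<tau>" "C > 0" "\<tau> > 0"
  shows "\<exists>C'>0. \<forall>n\<ge>1. \<forall>t. t > C' * (\<alpha> n powr \<tau> + 1 / (sqrt (real n) * \<alpha> n powr (1 + \<eta>))) \<longrightarrow>
      measure M {\<omega> \<in> space M.
        (\<integral>s. \<bar>kernel_density \<psi> \<alpha> n (\<lambda>j. X j \<omega>) s - \<Phi> s\<bar> \<partial>lborel) > t}
      \<le> C' / (t\<^sup>2 * real n * \<alpha> n powr (2 * \<eta>))"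
proof -
  interpret M: prob_space M by fact
  have X_meas [measurable]: "X k \<in> borel_measurable M" if "k \<ge> 1" for k
    using distributed_measurable[OF X[OF that]] by simp
  have \<Phi>_meas [measurable]: "\<Phi> \<in> borel_measurable borel"
    using distributed_real_measurable[OF _ X[of 1]] \<Phi> by simp
  \<comment> \<open>Testing the density against the constant 1 gives integrability.\<close>
  have \<Phi>_int: "integrable lborel \<Phi>"
    using distributed_integrable[OF X[of 1], of "\<lambda>_. 1"] \<Phi> by simp
  obtain D where D: "D > 0" and
    var: "\<And>n K c. \<lbrakk>n \<ge> 1; \<And>j x y. j \<in> {1..n} \<Longrightarrow> \<bar>K x - K (x(j := y))\<bar> \<le> c * \<bar>x j - y\<bar> powr \<eta>\<rbrakk>
      \<Longrightarrow> M.variance (\<lambda>\<omega>. K (\<lambda>i\<in>{1..n}. X i \<omega>)) \<le> D * (real n * c\<^sup>2)"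
    using devroye_variance_bound[OF dev \<eta>] by blast
  \<comment> \<open>Devroye's inequality is fed the vector cut to the first \<open>n\<close>
    coordinates, and the estimator reads no others. The bound is written \<open>Suc 0\<close> to
    match the simplifier's form of 1.\<close>
  have restrict: "kernel_density \<psi> \<alpha> n (\<lambda>i\<in>{Suc 0..n}. x i) = kernel_density \<psi> \<alpha> n x" for n x
    by (simp add: kernel_density_def fun_eq_iff)
  have "A > 0" using \<alpha>[of 1] by simp
  \<comment> \<open>Samples lie in \<open>{-B..B}\<close> and windows reach at most
    \<open>R * A\<close> further, so this interval serves all \<open>n\<close>.\<close>
  define S where "S = B + R * A"
  have S: "S > 0" using B(2) R_pos \<open>A > 0\<close> by (simp add: S_def add_pos_pos)
  \<comment> \<open>\<open>E0\<close> adds the coefficients of fluctuation and bias in the mean of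
    the error; \<open>V0\<close> is Devroye's constant times the squared L1 Hoelder factor, without
    \<open>n\<close> and \<open>\<alpha> n\<close>.\<close>
  define E0 where "E0 = 2 * S * (sqrt D * H) + C * R powr \<tau>"
  define V0 where "V0 = D * (4 * R * H)\<^sup>2"
  have E0: "E0 > 0" using S D H_pos mod R_pos by (auto simp: E0_def intro!: add_pos_pos mult_pos_pos)
  have V0: "V0 > 0" using D H_pos R_pos by (simp add: V0_def)
  show ?thesis
  \<comment> \<open>The summand \<open>2 * E0\<close> keeps the mean below \<open>t / 2\<close>, and
    \<open>4 * V0\<close> is the constant from Chebyshev's inequality.\<close>
  proof (intro exI[of _ "2 * E0 + 4 * V0"] conjI allI impI)
    show "2 * E0 + 4 * V0 > 0" using E0 V0 by simp
    fix n :: nat and t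
    assume n: "n \<ge> 1"
      and t: "t > (2 * E0 + 4 * V0) * (\<alpha> n powr \<tau> + 1 / (sqrt (real n) * \<alpha> n powr (1 + \<eta>)))"
    note a = \<alpha>(1)[OF n]
    define h where "h \<omega> = kernel_density \<psi> \<alpha> n (\<lambda>j. X j \<omega>)" for \<omega>
    define K where "K \<omega> = (\<integral>s. \<bar>h \<omega> s - \<Phi> s\<bar> \<partial>lborel)" for \<omega>
    define r where "r = \<alpha> n powr \<tau> + 1 / (sqrt (real n) * \<alpha> n powr (1 + \<eta>))"
    \<comment> \<open>This is the root of Devroye's bound for the estimator at one point, with
      \<open>sqrt n / n\<close> simplified.\<close>
    define \<sigma> where "\<sigma> = sqrt D * H / (sqrt (real n) * \<alpha> n powr (1 + \<eta>))"
    have [measurable]: "case_prod h \<in> borel_measurable (M \<Otimes>\<^sub>M lborel)"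
      unfolding h_def kernel_density_def by measurable
    have [measurable]: "(\<lambda>(\<omega>, s). \<bar>h \<omega> s - \<Phi> s\<bar>) \<in> borel_measurable (M \<Otimes>\<^sub>M lborel)" by measurable
    have K_meas [measurable]: "K \<in> borel_measurable M" unfolding K_def by measurable
    have h_int: "integrable M (\<lambda>\<omega>. h \<omega> s)" for s
      unfolding h_def by (rule expectation_kernel_density[of M n \<alpha> X \<Phi>, OF M n a X \<Phi>])
    have h_mean: "M.expectation (\<lambda>\<omega>. h \<omega> s) = (\<integral>x. \<Phi> x * (\<psi> ((s - x) / \<alpha> n) / \<alpha> n) \<partial>lborel)" for s
      unfolding h_def by (rule expectation_kernel_density[of M n \<alpha> X \<Phi>, OF M n a X \<Phi>])
    have h_dev: "M.expectation (\<lambda>\<omega>. \<bar>h \<omega> s - M.expectation (\<lambda>\<omega>. h \<omega> s)\<bar>) \<le> \<sigma>" for s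
    proof -
      have "integrable M (\<lambda>\<omega>. (h \<omega> s)\<^sup>2)"
      proof (rule M.integrable_const_bound)
        show "AE \<omega> in M. norm ((h \<omega> s)\<^sup>2) \<le> (H * (3 * R) powr \<eta> / \<alpha> n)\<^sup>2"
          unfolding h_def using kernel_density_le[of \<alpha> n, OF a n] kernel_density_nonneg[of \<alpha> n, OF a]
          by (intro AE_I2) (simp add: power_mono)
      qed measurable
      moreover have "M.variance (\<lambda>\<omega>. h \<omega> s) \<le> D * (real n * (H / (real n * \<alpha> n powr (1 + \<eta>)))\<^sup>2)"
        using var[of n "\<lambda>x. kernel_density \<psi> \<alpha> n x s", OF n kernel_density_pointwise_holder] a
        by (simp add: restrict h_def)
      ultimately have "M.expectation (\<lambda>\<omega>. \<bar>h \<omega> s - M.expectation (\<lambda>\<omega>. h \<omega> s)\<bar>)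
          \<le> sqrt (D * (real n * (H / (real n * \<alpha> n powr (1 + \<eta>)))\<^sup>2))"
        by (intro M.expectation_abs_deviation_le h_int)
      also have "\<dots> = sqrt D * H / \<alpha> n powr (1 + \<eta>) * (sqrt (real n) / real n)"
        using H_pos by (simp add: real_sqrt_mult real_sqrt_divide mult_ac)
      also have "\<dots> = \<sigma>"
        unfolding sqrt_divide_self_eq[OF of_nat_0_le_iff] by (simp add: \<sigma>_def inverse_eq_divide)
      finally show ?thesis .
    qed
    have "M.expectation K \<le> 2 * S * \<sigma> + C * R powr \<tau> * \<alpha> n powr \<tau>"
      unfolding K_def
    proof (rule M.expected_L1_error_le)
      show "h \<omega> s = 0" if "\<omega> \<in> space M" "\<bar>s\<bar> > S" for \<omega> s
        unfolding h_def
      proof (rule kernel_density_eq_0[where B=B])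
        have "R * \<alpha> n \<le> R * A" using \<alpha>(2) R_pos by (intro mult_left_mono) auto
        then show "\<bar>s\<bar> > B + R * \<alpha> n" using that by (simp add: S_def)
      qed (use a B that in auto)
      show "(\<integral>\<^sup>+s. ennreal \<bar>M.expectation (\<lambda>\<omega>. h \<omega> s) - \<Phi> s\<bar> \<partial>lborel)
          \<le> ennreal (C * R powr \<tau> * \<alpha> n powr \<tau>)"
        unfolding h_mean using mod by (intro smoothing_bias a \<Phi>_int) auto
      show "S \<ge> 0" "\<sigma> \<ge> 0" "C * R powr \<tau> * \<alpha> n powr \<tau> \<ge> 0"
        using S D H_pos mod by (auto simp: \<sigma>_def)
    qed (use h_int h_dev in auto)
    also have "\<dots> \<le> E0 * r"
    proof -
      \<comment> \<open>Expanding the product leaves the wanted bound and two nonnegative cross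
        terms, which are dropped.\<close>
      have "E0 * r = 2 * S * \<sigma> + C * R powr \<tau> * \<alpha> n powr \<tau> + 2 * S * (sqrt D * H) * \<alpha> n powr \<tau>
          + C * R powr \<tau> * (1 / (sqrt (real n) * \<alpha> n powr (1 + \<eta>)))"
        by (simp add: E0_def r_def \<sigma>_def algebra_simps)
      moreover have "2 * S * (sqrt D * H) * \<alpha> n powr \<tau> \<ge> 0"
        "C * R powr \<tau> * (1 / (sqrt (real n) * \<alpha> n powr (1 + \<eta>))) \<ge> 0"
        using S D H_pos mod by auto
      ultimately show ?thesis by linarith
    qed
    finally have EK: "M.expectation K \<le> E0 * r" .
    have r: "r > 0" using a n by (auto simp: r_def intro!: add_pos_nonneg)
    \<comment> \<open>This yields both the bound on the mean and, by positivity of the right-hand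
      side, \<open>t > 0\<close>.\<close>
    have tr: "t > 2 * (E0 * r) + 4 * V0 * r" using t by (simp add: r_def[symmetric] distrib_right)
    have pos: "E0 * r > 0" "4 * V0 * r > 0" using r E0 V0 by auto
    have varK: "M.variance K \<le> V0 / (real n * \<alpha> n powr (2 * \<eta>))"
    proof -
      have p: "(\<alpha> n powr \<eta>)\<^sup>2 = \<alpha> n powr (2 * \<eta>)"
        by (simp add: power2_eq_square flip: powr_add)
      have "M.variance K \<le> D * (real n * (4 * R * H / (real n * \<alpha> n powr \<eta>))\<^sup>2)"
        using var[of n "\<lambda>x. \<integral>s. \<bar>kernel_density \<psi> \<alpha> n x s - \<Phi> s\<bar> \<partial>lborel",
            OF n kernel_density_L1_error_holder] a \<Phi>_int
        by (simp add: restrict K_def[abs_def] h_def)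
      \<comment> \<open>The sum over \<open>n\<close> coordinates contributes \<open>n\<close> and
        the squared constant \<open>1 / n\<^sup>2\<close>, leaving one factor
        \<open>1 / n\<close>.\<close>
      also have "\<dots> = V0 / (real n * \<alpha> n powr (2 * \<eta>))"
        unfolding power_divide power_mult_distrib[of "real n"] p
        using n by (simp add: V0_def power2_eq_square[of "real n"])
      finally show ?thesis .
    qed
    have K2: "integrable M (\<lambda>\<omega>. (K \<omega>)\<^sup>2)"
    proof (rule M.integrable_const_bound)
      show "AE \<omega> in M. norm ((K \<omega>)\<^sup>2) \<le> (1 + (\<integral>s. \<Phi> s \<partial>lborel))\<^sup>2"
        unfolding K_def h_def using kernel_density_L1_error_le[of \<alpha> n, OF a n \<Phi>_int \<Phi>]
        by (intro AE_I2) (simp add: power_mono)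
    qed measurable
    have "measure M {\<omega> \<in> space M. K \<omega> > t} \<le> 4 * (V0 / (real n * \<alpha> n powr (2 * \<eta>))) / t\<^sup>2"
      using EK tr pos by (intro M.tail_le_of_expectation_variance K_meas K2 varK) linarith+
    also have "\<dots> = 4 * V0 / (t\<^sup>2 * real n * \<alpha> n powr (2 * \<eta>))" by (simp add: mult_ac)
    also have "\<dots> \<le> (2 * E0 + 4 * V0) / (t\<^sup>2 * real n * \<alpha> n powr (2 * \<eta>))"
      using E0 by (intro divide_right_mono) auto
    finally show "measure M {\<omega> \<in> space M.
        (\<integral>s. \<bar>kernel_density \<psi> \<alpha> n (\<lambda>j. X j \<omega>) s - \<Phi> s\<bar> \<partial>lborel) > t}
      \<le> (2 * E0 + 4 * V0) / (t\<^sup>2 * real n * \<alpha> n powr (2 * \<eta>))"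
      by (simp add: K_def h_def)
  qed
qed

end

section \<open>From the hypotheses on the kernel to the conclusion\<close>

lemma lipschitz_compact_support_holder_kernel:
  assumes bnd: "bounded (range \<psi>)" and nonneg: "\<And>x. \<psi> x \<ge> 0" and lip: "L-lipschitz_on UNIV \<psi>"
    and supp: "compact (closure {x. \<psi> x \<noteq> 0})" and one: "(\<integral>x. \<psi> x \<partial>lborel) = 1"
    and \<eta>: "\<eta> \<in> {0<..1}"
  shows "\<exists>R H. holder_kernel \<psi> R H \<eta>"
proof -
  obtain b where b: "\<And>x. \<bar>\<psi> x\<bar> \<le> b" using bnd by (auto simp: bounded_iff)
  have "bounded {x. \<psi> x \<noteq> 0}"
    using compact_imp_bounded[OF supp] closure_subset by (rule bounded_subset)
  then obtain R where R: "R > 0" "\<And>x. \<psi> x \<noteq> 0 \<Longrightarrow> \<bar>x\<bar> \<le> R"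
    by (auto simp: bounded_pos)
  \<comment> \<open>A non-integrable function has Bochner integral 0, so the value 1 forces
    integrability.\<close>
  have "integrable lborel \<psi>" using one not_integrable_integral_eq by fastforce
  \<comment> \<open>The extra 1 makes the Hoelder factor strictly positive, as the locale
    demands.\<close>
  moreover have "\<bar>\<psi> x - \<psi> y\<bar> \<le> (L + 2 * b + 1) * \<bar>x - y\<bar> powr \<eta>" for x y
  proof -
    have "\<bar>\<psi> x - \<psi> y\<bar> \<le> (L + 2 * b) * \<bar>x - y\<bar> powr \<eta>"
      using lipschitz_bounded_imp_holder_bound[OF lip b] \<eta> by auto
    also have "\<dots> \<le> (L + 2 * b + 1) * \<bar>x - y\<bar> powr \<eta>" by (intro mult_right_mono) auto
    finally show ?thesis .
  qed
  moreover have "L + 2 * b + 1 > 0" using lipschitz_on_nonneg[OF lip] b[of 0] by linarith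
  ultimately have "holder_kernel \<psi> R (L + 2 * b + 1) \<eta>"
    using nonneg one R \<eta> by unfold_locales auto
  then show ?thesis by blast
qed

theorem theorem6p1:
  fixes M :: "'a measure" and X :: "nat \<Rightarrow> 'a \<Rightarrow> real" and I :: "real set"
    and \<Phi> :: "real \<Rightarrow> real" and \<alpha> :: "nat \<Rightarrow> real" and C \<tau> :: real
  assumes "prob_space M"
    and "\<And>k. k \<ge> 1 \<Longrightarrow> X k \<in> borel_measurable M"
    and "stationary M X" and "ergodic M X"
    and "is_interval I" and "bounded I"
    and "\<And>k \<omega>. k \<ge> 1 \<Longrightarrow> \<omega> \<in> space M \<Longrightarrow> X k \<omega> \<in> I"
    and "devroye_inequality M X"
    and "\<And>s. \<Phi> s \<ge> 0"
    and "\<And>k. k \<ge> 1 \<Longrightarrow> distributed M lborel (X k) (\<lambda>s. ennreal (\<Phi> s))"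
    and "\<And>n. n \<ge> 1 \<Longrightarrow> \<alpha> n > 0"
    and "\<alpha> \<longlonglongrightarrow> 0"
    and "filterlim (\<lambda>n. real n * \<alpha> n) at_top sequentially"
    and "C > 0" and "\<tau> > 0"
    and "\<And>y. (\<integral>s. \<bar>\<Phi> s - \<Phi> (s - y)\<bar> \<partial>lborel) \<le> C * \<bar>y\<bar> powr \<tau>"
    and "\<And>\<eta>. \<eta> \<in> {0<..1} \<Longrightarrow> \<exists>C\<^sub>\<eta>>0. \<forall>u. holder \<eta> u \<longrightarrow>
           summable (\<lambda>l. \<bar>auto_cov M X u (Suc l)\<bar>) \<and>
           (\<Sum>l. \<bar>auto_cov M X u (Suc l)\<bar>) \<le> C\<^sub>\<eta> * (holder_const \<eta> u)\<^sup>2"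
  shows "\<forall>\<eta>\<in>{0<..1}. \<forall>\<psi> :: real \<Rightarrow> real.
           bounded (range \<psi>) \<and> (\<forall>x. \<psi> x \<ge> 0) \<and> (\<exists>L. L-lipschitz_on UNIV \<psi>) \<and>
           compact (closure {x. \<psi> x \<noteq> 0}) \<and> (\<integral>x. \<psi> x \<partial>lborel) = 1 \<longrightarrow>
           (\<exists>C'>0. \<forall>n\<ge>1. \<forall>t. t > C' * (\<alpha> n powr \<tau> + 1 / (sqrt (real n) * \<alpha> n powr (1 + \<eta>))) \<longrightarrow>
              measure M {\<omega> \<in> space M.
                (\<integral>s. \<bar>kernel_density \<psi> \<alpha> n (\<lambda>j. X j \<omega>) s - \<Phi> s\<bar> \<partial>lborel) > t}
              \<le> C' / (t\<^sup>2 * real n * \<alpha> n powr (2 * \<eta>)))"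
proof (intro ballI allI impI)
  fix \<eta> :: real and \<psi> :: "real \<Rightarrow> real"
  assume \<eta>: "\<eta> \<in> {0<..1}"
    and \<psi>: "bounded (range \<psi>) \<and> (\<forall>x. \<psi> x \<ge> 0) \<and> (\<exists>L. L-lipschitz_on UNIV \<psi>) \<and>
      compact (closure {x. \<psi> x \<noteq> 0}) \<and> (\<integral>x. \<psi> x \<partial>lborel) = 1"
  obtain R H where "holder_kernel \<psi> R H \<eta>"
    using lipschitz_compact_support_holder_kernel \<psi> \<eta> by metis
  then interpret holder_kernel \<psi> R H \<eta> .
  obtain B where B: "B > 0" "\<And>x. x \<in> I \<Longrightarrow> \<bar>x\<bar> \<le> B"
    using \<open>bounded I\<close> by (auto simp: bounded_pos)
  \<comment> \<open>The limit serves only to bound the bandwidths. The bound covers all indices,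
    including \<open>\<alpha> 0\<close>, whose sign is unspecified.\<close>
  obtain A where A: "\<And>n. \<bar>\<alpha> n\<bar> \<le> A"
    using convergent_imp_Bseq[OF convergentI[OF \<open>\<alpha> \<longlonglongrightarrow> 0\<close>]] unfolding Bseq_def real_norm_def by blast
  show "\<exists>C'>0. \<forall>n\<ge>1. \<forall>t. t > C' * (\<alpha> n powr \<tau> + 1 / (sqrt (real n) * \<alpha> n powr (1 + \<eta>))) \<longrightarrow>
      measure M {\<omega> \<in> space M.
        (\<integral>s. \<bar>kernel_density \<psi> \<alpha> n (\<lambda>j. X j \<omega>) s - \<Phi> s\<bar> \<partial>lborel) > t}
      \<le> C' / (t\<^sup>2 * real n * \<alpha> n powr (2 * \<eta>))"
  proof (rule devroye_tail_bound)
    show "\<bar>X k \<omega>\<bar> \<le> B" if "k \<ge> 1" "\<omega> \<in> space M" for k \<omega>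
      by (intro B(2) assms(7) that)
    show "\<alpha> n \<le> A" for n using A[of n] by simp
  qed (use assms \<eta> B in auto)
qed

end
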